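(* There exists an absolute constant $C>0$ (independent of $d,\rho,\tau$ and the triangulation) such that the following holds. Let $d\ge1$, let $\Omega\subset\mathbb{R}^d$ be a bounded polyhedral domain, and let $\mathcal{T}_h$ be a $\rho$-shape-regular triangulation of $\Omega$. Then for any $\tau\in\mathcal{T}_h$, $$|v|_{H^1(\tau)}\le C\,\rho\,d^{3/2}\,h_\tau^{-1}\,\|v\|_{L^2(\tau)},\qquad v\in\mathbb{P}_1(\tau).$$
   Context: A triangulation $\mathcal{T}_h$ of $\Omega$ is a finite conforming collection of pairwise disjoint open $d$-simplices whose closures have union $\overline\Omega$. For a $d$-simplex $\tau$, $h_\tau$ is its diameter and $r_\tau$ its inradius. $\mathcal{T}_h$ is $\rho$-shape-regular ($\rho>0$) if $h_\tau\le\rho\,r_\tau$ for all $\tau\in\mathcal{T}_h$. $\mathbb{P}_1(\tau)$ is the space of affine functions on $\tau$, and $|v|_{H^1(\tau)}=\|\nabla v\|_{L^2(\tau)}$. *)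

theory Defs
  imports "HOL-Analysis.Analysis"
begin

text \<open>The constant of the theorem must not depend on the dimension, so \<open>d\<close> has to be quantified
  inside the formula and cannot be a type. Points of the \<open>d\<close>-dimensional Euclidean space are
  therefore the functions in \<open>{..<d} \<rightarrow>\<^sub>E UNIV\<close>, the common carrier of the library's product
  topology and product measure over the index set \<open>{..<d}\<close>.\<close>

type_synonym point = "nat \<Rightarrow> real"

abbreviation Rd :: "nat \<Rightarrow> point set" where
  "Rd d \<equiv> {..<d} \<rightarrow>\<^sub>E (UNIV :: real set)"

abbreviation top_Rd :: "nat \<Rightarrow> point topology" where
  "top_Rd d \<equiv> product_topology (\<lambda>_. euclideanreal) {..<d}"

abbreviation leb_Rd :: "nat \<Rightarrow> point measure" where
  "leb_Rd d \<equiv> Pi\<^sub>M {..<d} (\<lambda>_. lborel)"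

definition edist :: "nat \<Rightarrow> point \<Rightarrow> point \<Rightarrow> real" where
  "edist d x y = L2_set (\<lambda>i. x i - y i) {..<d}"

definition eball :: "nat \<Rightarrow> point \<Rightarrow> real \<Rightarrow> point set" where
  "eball d x r = {y \<in> Rd d. edist d x y < r}"

definition ediameter :: "nat \<Rightarrow> point set \<Rightarrow> real" where
  "ediameter d S = (SUP (x, y) \<in> S \<times> S. edist d x y)"

definition inradius :: "nat \<Rightarrow> point set \<Rightarrow> real" where
  "inradius d S = Sup {r. 0 < r \<and> (\<exists>x \<in> Rd d. eball d x r \<subseteq> S)}"

definition aff_indep :: "nat \<Rightarrow> point set \<Rightarrow> bool" where
  "aff_indep d V \<longleftrightarrow>
     (\<forall>c. (\<Sum>p\<in>V. c p) = 0 \<and> (\<forall>i<d. (\<Sum>p\<in>V. c p * p i) = 0) \<longrightarrow> (\<forall>p\<in>V. c p = (0::real)))"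

definition lin_comb :: "nat \<Rightarrow> point set \<Rightarrow> (point \<Rightarrow> real) \<Rightarrow> point" where
  "lin_comb d V c = (\<lambda>i\<in>{..<d}. \<Sum>p\<in>V. c p * p i)"

text \<open>The next two are only meant for finite \<open>V\<close>; both are empty for \<open>V = {}\<close>. The second one
  is the relative interior of the first one if \<open>V\<close> is affinely independent.\<close>

definition conv_hull :: "nat \<Rightarrow> point set \<Rightarrow> point set" where
  "conv_hull d V = {lin_comb d V c |c. (\<forall>p\<in>V. 0 \<le> c p) \<and> (\<Sum>p\<in>V. c p) = 1}"

definition open_conv_hull :: "nat \<Rightarrow> point set \<Rightarrow> point set" where
  "open_conv_hull d V = {lin_comb d V c |c. (\<forall>p\<in>V. 0 < c p) \<and> (\<Sum>p\<in>V. c p) = 1}"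

definition vertices_of :: "nat \<Rightarrow> point set \<Rightarrow> point set \<Rightarrow> bool" where
  "vertices_of d V \<tau> \<longleftrightarrow>
     finite V \<and> V \<subseteq> Rd d \<and> card V = d + 1 \<and> aff_indep d V \<and> \<tau> = open_conv_hull d V"

definition open_simplex :: "nat \<Rightarrow> point set \<Rightarrow> bool" where
  "open_simplex d \<tau> \<longleftrightarrow> (\<exists>V. vertices_of d V \<tau>)"

text \<open>The faces of the closed simplex \<open>top_Rd d closure_of \<tau>\<close>, including the empty face and the
  closed simplex itself.\<close>

definition simplex_face :: "nat \<Rightarrow> point set \<Rightarrow> point set \<Rightarrow> bool" where
  "simplex_face d F \<tau> \<longleftrightarrow> (\<exists>V W. vertices_of d V \<tau> \<and> W \<subseteq> V \<and> F = conv_hull d W)"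

text \<open>A domain is a nonempty connected open set. It is polyhedral if its boundary is a finite union
  of convex polytopes; these have dimension less than \<open>d\<close>, as the boundary of an open set has empty
  interior. Neither convexity nor a Lipschitz boundary is required.\<close>

definition bounded_polyhedral_domain :: "nat \<Rightarrow> point set \<Rightarrow> bool" where
  "bounded_polyhedral_domain d \<Omega> \<longleftrightarrow>
     \<Omega> \<noteq> {} \<and> openin (top_Rd d) \<Omega> \<and> connectedin (top_Rd d) \<Omega> \<and>
     (\<exists>B. \<forall>x\<in>\<Omega>. L2_set x {..<d} \<le> B) \<and>
     (\<exists>\<V>. finite \<V> \<and> (\<forall>V\<in>\<V>. finite V \<and> V \<subseteq> Rd d) \<and>
          top_Rd d frontier_of \<Omega> = (\<Union>V\<in>\<V>. conv_hull d V))"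

definition triangulation_of :: "nat \<Rightarrow> point set \<Rightarrow> point set set \<Rightarrow> bool" where
  "triangulation_of d \<Omega> \<T> \<longleftrightarrow>
     finite \<T> \<and> (\<forall>\<tau>\<in>\<T>. open_simplex d \<tau>) \<and> pairwise disjnt \<T> \<and>
     (\<Union>\<tau>\<in>\<T>. top_Rd d closure_of \<tau>) = top_Rd d closure_of \<Omega> \<and>
     (\<forall>\<sigma>\<in>\<T>. \<forall>\<tau>\<in>\<T>.
        simplex_face d (top_Rd d closure_of \<sigma> \<inter> top_Rd d closure_of \<tau>) \<sigma> \<and>
        simplex_face d (top_Rd d closure_of \<sigma> \<inter> top_Rd d closure_of \<tau>) \<tau>)"

definition shape_regular :: "nat \<Rightarrow> real \<Rightarrow> point set set \<Rightarrow> bool" where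
  "shape_regular d \<rho> \<T> \<longleftrightarrow> 0 < \<rho> \<and> (\<forall>\<tau>\<in>\<T>. ediameter d \<tau> \<le> \<rho> * inradius d \<tau>)"

text \<open>Values of \<open>v\<close> outside \<open>\<tau>\<close> are unconstrained. They affect neither of the two norms on \<open>\<tau>\<close>,
  since \<open>\<tau>\<close> is open.\<close>

definition P1 :: "nat \<Rightarrow> point set \<Rightarrow> (point \<Rightarrow> real) set" where
  "P1 d \<tau> = {v. \<exists>a b. \<forall>x\<in>\<tau>. v x = b + (\<Sum>i<d. a i * x i)}"

definition partial_deriv :: "nat \<Rightarrow> (point \<Rightarrow> real) \<Rightarrow> point \<Rightarrow> real" where
  "partial_deriv i v x = deriv (\<lambda>t. v (x(i := t))) (x i)"

definition L2_norm_on :: "nat \<Rightarrow> point set \<Rightarrow> (point \<Rightarrow> real) \<Rightarrow> real" where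
  "L2_norm_on d \<tau> v = sqrt (LINT x:\<tau>|leb_Rd d. (v x)\<^sup>2)"

definition H1_seminorm_on :: "nat \<Rightarrow> point set \<Rightarrow> (point \<Rightarrow> real) \<Rightarrow> real" where
  "H1_seminorm_on d \<tau> v = L2_norm_on d \<tau> (\<lambda>x. L2_set (\<lambda>i. partial_deriv i v x) {..<d})"

end

theory Submission
  imports Defs
begin

text \<open>Let \<open>\<bar>\<tau>\<bar>\<close> be the volume of \<open>\<tau>\<close>, let \<open>f\<close> be affine, \<open>p \<in> \<tau>\<close> and \<open>t = 1 / (2d)\<close>. The homothety
  \<open>T x = (1 - t) x + t p\<close> maps \<open>\<tau>\<close> into itself and shrinks volumes by \<open>(1 - t)\<^sup>d \<ge> 1/2\<close>, so the
  integral of \<open>(f \<circ> T)\<^sup>2\<close> over \<open>\<tau>\<close> is at most twice that of \<open>f\<^sup>2\<close>. As \<open>t f(p) = f(T x) - (1 - t) f(x)\<close>,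
  integrating the square over \<open>\<tau>\<close> bounds \<open>f(p)\<^sup>2 \<bar>\<tau>\<bar>\<close> by \<open>24 d\<^sup>2\<close> times the integral of \<open>f\<^sup>2\<close>. A ball of
  radius \<open>r\<close> inside \<open>\<tau>\<close> contains a point \<open>p\<close> at which \<open>\<bar>f(p)\<bar>\<close> is at least \<open>r/2\<close> times the length of the
  gradient of \<open>f\<close>, and shape regularity compares the inradius with the diameter.\<close>

section \<open>Linear algebra and barycentric coordinates\<close>

lemma homogeneous_system_nontrivial_solution:
  fixes f :: "'a \<Rightarrow> nat \<Rightarrow> real"
  assumes "finite I" "n < card I"
  shows "\<exists>c. (\<exists>p\<in>I. c p \<noteq> 0) \<and> (\<forall>i<n. (\<Sum>p\<in>I. c p * f p i) = 0)"
  using assms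
proof (induction n arbitrary: I f)
  case 0
  then have "I \<noteq> {}" by auto
  then show ?case by (intro exI[of _ "\<lambda>_. 1"]) auto
next
  case (Suc n)
  show ?case
  proof (cases "\<forall>p\<in>I. f p n = 0")
    case True
    from Suc.IH[of I f] Suc.prems obtain c where
      c: "\<exists>p\<in>I. c p \<noteq> 0" "\<forall>i<n. (\<Sum>p\<in>I. c p * f p i) = 0" by auto
    with True show ?thesis by (intro exI[of _ c]) (auto simp: less_Suc_eq)
  next
    case False
    then obtain q where q: "q \<in> I" "f q n \<noteq> 0" by auto
    define J where "J = I - {q}"
    have J: "finite J" "n < card J" "q \<notin> J" "I = insert q J"
      using Suc.prems q by (simp_all add: J_def insert_absorb)
    from Suc.IH[OF J(1,2), of "\<lambda>p i. f p i - f p n / f q n * f q i"] obtain c where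
      c: "\<exists>p\<in>J. c p \<noteq> 0"
        "\<And>i. i < n \<Longrightarrow> (\<Sum>p\<in>J. c p * (f p i - f p n / f q n * f q i)) = 0" by auto
    \<comment> \<open>The value at \<open>q\<close> is the one that equation \<open>n\<close>
      forces. Substituting it into equation \<open>i\<close> gives the reduced equation; for
      \<open>i = n\<close> every reduced coefficient is zero.\<close>
    define e where "e = c(q := - (\<Sum>p\<in>J. c p * f p n) / f q n)"
    have sum_e: "(\<Sum>p\<in>I. e p * f p i) = e q * f q i + (\<Sum>p\<in>J. c p * f p i)" for i
    proof -
      have "(\<Sum>p\<in>J. e p * f p i) = (\<Sum>p\<in>J. c p * f p i)"
        using J(3) by (intro sum.cong) (auto simp: e_def)
      then show ?thesis using J by simp
    qed
    have eq: "(\<Sum>p\<in>I. e p * f p i) = (\<Sum>p\<in>J. c p * (f p i - f p n / f q n * f q i))" for i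
      unfolding sum_e
      by (simp add: e_def algebra_simps sum_subtractf sum_divide_distrib sum_distrib_left)
    have "(\<Sum>p\<in>I. e p * f p i) = 0" if "i < Suc n" for i
      using that c(2) q(2) by (auto simp: less_Suc_eq eq)
    moreover have "\<exists>p\<in>I. e p \<noteq> 0"
      using c(1) J(3,4) by (auto simp: e_def)
    ultimately show ?thesis by blast
  qed
qed

text \<open>The right-hand side is treated as one more column: \<open>d + 1\<close> homogeneous
  equations in \<open>d + 2\<close> unknowns have a nontrivial solution. Affine independence of the
  vertices forces its coefficient at the extra column to be nonzero, so one can divide by
  it.\<close>

lemma affine_combination_exists:
  assumes "vertices_of d V \<tau>"
  shows "\<exists>c. (\<Sum>p\<in>V. c p) = w \<and> (\<forall>i<d. (\<Sum>p\<in>V. c p * p i) = z i)"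
proof -
  have V: "finite V" "card V = d + 1" "aff_indep d V"
    using assms by (auto simp: vertices_of_def)
  \<comment> \<open>\<open>None\<close> is the right-hand side and \<open>Some p\<close> the vertex
    \<open>p\<close>. Component \<open>0\<close> carries the sum of the weights, component
    \<open>Suc i\<close> the coordinate \<open>i\<close>.\<close>
  define f where "f = (\<lambda>q k. case q of
    None \<Rightarrow> (case k of 0 \<Rightarrow> w | Suc i \<Rightarrow> z i) | Some p \<Rightarrow> (case k of 0 \<Rightarrow> 1 | Suc i \<Rightarrow> p i))"
  have "card (insert None (Some ` V)) = d + 2"
    using V by (simp add: card_image)
  then obtain c where c: "\<exists>q\<in>insert None (Some ` V). c q \<noteq> 0"
    "\<And>k. k < d + 1 \<Longrightarrow> (\<Sum>q\<in>insert None (Some ` V). c q * f q k) = 0"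
    using homogeneous_system_nontrivial_solution[of "insert None (Some ` V)" "d + 1" f] V by auto
  have sum_eq: "c None * f None k + (\<Sum>p\<in>V. c (Some p) * f (Some p) k) = 0" if "k < d + 1" for k
    using c(2)[OF that] V by (simp add: sum.reindex)
  have s0: "c None * w + (\<Sum>p\<in>V. c (Some p)) = 0"
    using sum_eq[of 0] by (simp add: f_def)
  have si: "c None * z i + (\<Sum>p\<in>V. c (Some p) * p i) = 0" if "i < d" for i
    using sum_eq[of "Suc i"] that by (simp add: f_def)
  have "c None \<noteq> 0"
  proof
    assume "c None = 0"
    with s0 si V(3) have "\<forall>p\<in>V. c (Some p) = 0"
      unfolding aff_indep_def by (elim allE[of _ "\<lambda>p. c (Some p)"]) auto
    with c(1) \<open>c None = 0\<close> show False by auto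
  qed
  with s0 si show ?thesis
    by (intro exI[of _ "\<lambda>p. - c (Some p) / c None"])
       (auto simp: sum_negf sum_divide_distrib[symmetric] field_simps add_eq_0_iff)
qed

text \<open>Barycentric coordinates are affine functions of the point, and the open simplex is the
  set where all of them are positive. This description yields measurability, convexity and openness
  below.\<close>

lemma open_simplex_eq_halfspaces:
  assumes "vertices_of d V \<tau>"
  shows "\<exists>\<beta> \<alpha>. \<tau> = {y \<in> Rd d. \<forall>p\<in>V. 0 < \<beta> p + (\<Sum>i<d. \<alpha> p i * y i)}"
proof -
  have V: "finite V" "aff_indep d V" "\<tau> = open_conv_hull d V"
    using assms by (auto simp: vertices_of_def)
  \<comment> \<open>\<open>\<beta>\<close> represents the origin with total weight 1, and
    \<open>A i\<close> below represents the \<open>i\<close>-th unit vector with total weight 0. By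
    linearity \<open>b y\<close> then consists of the barycentric coordinates of
    \<open>y\<close>.\<close>
  obtain \<beta> where \<beta>: "(\<Sum>p\<in>V. \<beta> p) = 1" "\<And>j. j < d \<Longrightarrow> (\<Sum>p\<in>V. \<beta> p * p j) = 0"
    using affine_combination_exists[OF assms, of 1 "\<lambda>_. 0"] by auto
  have "\<forall>i. \<exists>c. (\<Sum>p\<in>V. c p) = 0 \<and> (\<forall>j<d. (\<Sum>p\<in>V. c p * p j) = of_bool (i = j))"
    using affine_combination_exists[OF assms, of 0] by auto
  then obtain A where A: "\<And>i. (\<Sum>p\<in>V. A i p) = 0"
    "\<And>i j. j < d \<Longrightarrow> (\<Sum>p\<in>V. A i p * p j) = of_bool (i = j)" by metis
  define b where "b = (\<lambda>y p. \<beta> p + (\<Sum>i<d. A i p * y i))"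
  have b1: "(\<Sum>p\<in>V. b y p) = 1" for y :: point
  proof -
    have "(\<Sum>p\<in>V. \<Sum>i<d. A i p * y i) = (\<Sum>i<d. (\<Sum>p\<in>V. A i p) * y i)"
      by (subst sum.swap) (simp add: sum_distrib_right)
    then show ?thesis by (simp add: b_def sum.distrib \<beta> A)
  qed
  have b2: "(\<Sum>p\<in>V. b y p * p j) = y j" if "j < d" for y :: point and j
  proof -
    have "(\<Sum>p\<in>V. (\<Sum>i<d. A i p * y i) * p j) = (\<Sum>i<d. (\<Sum>p\<in>V. A i p * p j) * y i)"
      unfolding sum_distrib_right by (subst sum.swap) (simp add: mult_ac)
    also have "\<dots> = (\<Sum>i<d. if i = j then y i else 0)"
      using that by (intro sum.cong) (auto simp: A)
    also have "\<dots> = y j" using that by simp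
    finally show ?thesis by (simp add: b_def sum.distrib \<beta> that distrib_right)
  qed
  have "\<tau> = {y \<in> Rd d. \<forall>p\<in>V. 0 < b y p}"
  proof (intro set_eqI iffI)
    fix y assume "y \<in> \<tau>"
    then obtain c where c: "y = lin_comb d V c" "\<forall>p\<in>V. 0 < c p" "(\<Sum>p\<in>V. c p) = 1"
      by (auto simp: V open_conv_hull_def)
    \<comment> \<open>Uniqueness of barycentric coordinates: two representations of \<open>y\<close>
      differ by an affine dependence, which must vanish.\<close>
    have "(\<Sum>p\<in>V. b y p - c p) = 0 \<and> (\<forall>i<d. (\<Sum>p\<in>V. (b y p - c p) * p i) = 0)"
      using c by (simp add: sum_subtractf b1 b2 left_diff_distrib) (simp add: lin_comb_def)
    then have "\<forall>p\<in>V. b y p - c p = 0"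
      using V(2) unfolding aff_indep_def by (elim allE[of _ "\<lambda>p. b y p - c p"]) auto
    then show "y \<in> {y \<in> Rd d. \<forall>p\<in>V. 0 < b y p}"
      using c by (auto simp: lin_comb_def)
  next
    fix y assume y: "y \<in> {y \<in> Rd d. \<forall>p\<in>V. 0 < b y p}"
    then have "y = lin_comb d V (b y)"
      unfolding lin_comb_def by (auto simp: fun_eq_iff b2 restrict_def PiE_def extensional_def)
    then show "y \<in> \<tau>" using y b1 by (auto simp: V open_conv_hull_def)
  qed
  then show ?thesis
    by (intro exI[of _ \<beta>] exI[of _ "\<lambda>p i. A i p"]) (simp add: b_def)
qed

section \<open>Elementary geometry of open simplices\<close>

lemma open_simplex_measurable:
  assumes "open_simplex d \<tau>"
  shows "\<tau> \<in> sets (leb_Rd d)"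
proof -
  obtain V where V: "vertices_of d V \<tau>" using assms by (auto simp: open_simplex_def)
  then have "finite V" by (simp add: vertices_of_def)
  obtain \<beta> \<alpha> where eq: "\<tau> = {y \<in> Rd d. \<forall>p\<in>V. 0 < \<beta> p + (\<Sum>i<d. \<alpha> p i * y i)}"
    using open_simplex_eq_halfspaces[OF V] by auto
  have "{y \<in> space (leb_Rd d). \<forall>p\<in>V. 0 < \<beta> p + (\<Sum>i<d. \<alpha> p i * y i)} \<in> sets (leb_Rd d)"
    using \<open>finite V\<close> by measurable
  then show ?thesis by (simp add: eq space_PiM)
qed

lemma open_simplex_nonempty:
  assumes "open_simplex d \<tau>"
  shows "\<tau> \<noteq> {}"
proof -
  obtain V where "finite V" "card V = d + 1" "\<tau> = open_conv_hull d V"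
    using assms by (auto simp: open_simplex_def vertices_of_def)
  then have "lin_comb d V (\<lambda>_. 1 / (d + 1)) \<in> \<tau>"
    by (auto simp: open_conv_hull_def intro!: exI[of _ "\<lambda>_. 1 / (d + 1)"])
  then show ?thesis by auto
qed

lemma open_simplex_subset: "open_simplex d \<tau> \<Longrightarrow> \<tau> \<subseteq> Rd d"
  unfolding open_simplex_def vertices_of_def open_conv_hull_def lin_comb_def
  by (auto split: if_splits)

lemma open_simplex_bounded:
  assumes "open_simplex d \<tau>"
  obtains B where "\<And>y i. y \<in> \<tau> \<Longrightarrow> i < d \<Longrightarrow> \<bar>y i\<bar> \<le> B"
proof -
  obtain V where V: "finite V" "\<tau> = open_conv_hull d V"
    using assms by (auto simp: open_simplex_def vertices_of_def)
  \<comment> \<open>Weights are at most 1; summing over all coordinates makes the bound independent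
    of \<open>i\<close>.\<close>
  have "\<bar>y i\<bar> \<le> (\<Sum>i<d. \<Sum>p\<in>V. \<bar>p i\<bar>)" if y: "y \<in> \<tau>" and i: "i < d" for y i
  proof -
    obtain c where c: "y = lin_comb d V c" "\<forall>p\<in>V. 0 < c p" "(\<Sum>p\<in>V. c p) = 1"
      using y by (auto simp: V open_conv_hull_def)
    have "c p \<le> 1" if "p \<in> V" for p
      using member_le_sum[of p V c] that c V(1) by (auto intro: less_imp_le)
    then have "(\<Sum>p\<in>V. \<bar>c p * p i\<bar>) \<le> (\<Sum>p\<in>V. \<bar>p i\<bar>)"
      using c by (intro sum_mono) (auto simp: abs_mult mult_left_le_one_le less_imp_le)
    then have "\<bar>\<Sum>p\<in>V. c p * p i\<bar> \<le> (\<Sum>p\<in>V. \<bar>p i\<bar>)"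
      by (rule order_trans[OF sum_abs])
    then have "\<bar>y i\<bar> \<le> (\<Sum>p\<in>V. \<bar>p i\<bar>)"
      using c(1) i by (simp add: lin_comb_def)
    also have "\<dots> \<le> (\<Sum>i<d. \<Sum>p\<in>V. \<bar>p i\<bar>)"
      using i by (intro member_le_sum) (auto intro: sum_nonneg)
    finally show ?thesis .
  qed
  then show thesis by (rule that)
qed

text \<open>Convexity: each defining strict inequality is affine, so it survives convex
  combinations. The map is read as the homothety with centre \<open>p\<close> and ratio
  \<open>s\<close>.\<close>

lemma open_simplex_homothety:
  assumes "open_simplex d \<tau>" "x \<in> \<tau>" "p \<in> \<tau>" "0 < s" "s < 1"
  shows "(\<lambda>i\<in>{..<d}. s * x i + (1 - s) * p i) \<in> \<tau>"
proof -
  obtain V where V: "vertices_of d V \<tau>" using assms by (auto simp: open_simplex_def)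
  obtain \<beta> \<alpha> where eq: "\<tau> = {y \<in> Rd d. \<forall>p\<in>V. 0 < \<beta> p + (\<Sum>i<d. \<alpha> p i * y i)}"
    using open_simplex_eq_halfspaces[OF V] by auto
  have "0 < \<beta> q + (\<Sum>i<d. \<alpha> q i * (s * x i + (1 - s) * p i))" if q: "q \<in> V" for q
  proof -
    have "0 < s * (\<beta> q + (\<Sum>i<d. \<alpha> q i * x i)) + (1 - s) * (\<beta> q + (\<Sum>i<d. \<alpha> q i * p i))"
      using assms q by (intro add_pos_pos[of "s * _"] mult_pos_pos) (auto simp: eq)
    then show ?thesis
      by (simp add: algebra_simps sum.distrib sum_distrib_left sum_subtractf)
  qed
  then show ?thesis by (simp add: eq)
qed

lemma coord_le_edist: "i < d \<Longrightarrow> \<bar>x i - y i\<bar> \<le> edist d x y"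
  using member_le_L2_set[of "{..<d}" i "\<lambda>i. \<bar>x i - y i\<bar>"]
  by (simp add: edist_def L2_set_def)

lemma edist_fun_upd:
  assumes "j < d"
  shows "edist d x (x(j := t)) = \<bar>x j - t\<bar>"
proof -
  have "(\<Sum>i<d. (x i - (x(j := t)) i)\<^sup>2) = (\<Sum>i<d. if i = j then (x j - t)\<^sup>2 else 0)"
    by (intro sum.cong) auto
  then show ?thesis using assms by (simp add: edist_def L2_set_def)
qed

lemma open_simplex_contains_eball:
  assumes "open_simplex d \<tau>" "x \<in> \<tau>"
  obtains r where "0 < r" "eball d x r \<subseteq> \<tau>"
proof -
  obtain V where V: "vertices_of d V \<tau>" using assms by (auto simp: open_simplex_def)
  then have "finite V" by (simp add: vertices_of_def)
  obtain \<beta> \<alpha> where eq: "\<tau> = {y \<in> Rd d. \<forall>p\<in>V. 0 < \<beta> p + (\<Sum>i<d. \<alpha> p i * y i)}"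
    using open_simplex_eq_halfspaces[OF V] by auto
  \<comment> \<open>Barycentric coordinate of \<open>x\<close> divided by more than its Lipschitz
    constant: within distance \<delta> of \<open>x\<close> the coordinate stays positive. The
    summand 1 avoids division by zero and makes the estimate strict.\<close>
  define \<delta> where "\<delta> = (\<lambda>p. (\<beta> p + (\<Sum>i<d. \<alpha> p i * x i)) / (1 + (\<Sum>i<d. \<bar>\<alpha> p i\<bar>)))"
  define r where "r = Min (insert 1 (\<delta> ` V))"
  have K: "0 < 1 + (\<Sum>i<d. \<bar>\<alpha> p i\<bar>)" for p
    by (intro add_pos_nonneg sum_nonneg) auto
  have "0 < r"
    using \<open>finite V\<close> K assms(2) by (auto simp: r_def \<delta>_def eq)
  moreover have "y \<in> \<tau>" if y: "y \<in> eball d x r" for y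
  proof -
    have "0 < \<beta> p + (\<Sum>i<d. \<alpha> p i * y i)" if p: "p \<in> V" for p
    proof -
      have e: "\<bar>x i - y i\<bar> \<le> r" if "i < d" for i
        using coord_le_edist[OF that, of x y] y by (auto simp: eball_def)
      have "(\<Sum>i<d. \<alpha> p i * x i) - (\<Sum>i<d. \<alpha> p i * y i) = (\<Sum>i<d. \<alpha> p i * (x i - y i))"
        by (simp add: algebra_simps sum_subtractf)
      also have "\<dots> \<le> (\<Sum>i<d. \<bar>\<alpha> p i\<bar> * r)"
      proof (intro sum_mono)
        fix i assume "i \<in> {..<d}"
        then have "\<bar>\<alpha> p i\<bar> * \<bar>x i - y i\<bar> \<le> \<bar>\<alpha> p i\<bar> * r" using e by (intro mult_left_mono) auto
        then show "\<alpha> p i * (x i - y i) \<le> \<bar>\<alpha> p i\<bar> * r"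
          by (metis abs_le_D1 abs_mult)
      qed
      also have "\<dots> < r * (1 + (\<Sum>i<d. \<bar>\<alpha> p i\<bar>))"
        using \<open>0 < r\<close> by (simp add: distrib_left sum_distrib_left mult.commute)
      also have "\<dots> \<le> \<delta> p * (1 + (\<Sum>i<d. \<bar>\<alpha> p i\<bar>))"
        using \<open>finite V\<close> p K[of p] by (intro mult_right_mono) (auto simp: r_def)
      also have "\<dots> = \<beta> p + (\<Sum>i<d. \<alpha> p i * x i)"
        using K[of p] by (simp add: \<delta>_def)
      finally show ?thesis by simp
    qed
    then show ?thesis using y by (auto simp: eq eball_def)
  qed
  ultimately show thesis by (intro that) auto
qed

section \<open>Homotheties and Lebesgue measure\<close>

text \<open>The homothety acts on each coordinate separately, as an affine map of the line with
  slope \<open>s\<close>; the \<open>d\<close> one-dimensional factors multiply to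
  \<open>s ^ d\<close>. The form \<open>density (distr ...)\<close> lets integrals be transferred
  directly.\<close>

lemma leb_Rd_homothety:
  fixes d :: nat and p :: point
  assumes "0 < s"
  defines "T \<equiv> \<lambda>x. \<lambda>i\<in>{..<d}. s * x i + (1 - s) * p i"
  shows "leb_Rd d = density (distr (leb_Rd d) (leb_Rd d) T) (\<lambda>_. ennreal (s ^ d))"
proof -
  interpret product_sigma_finite "\<lambda>_::nat. lborel :: real measure" ..
  have T: "T \<in> measurable (leb_Rd d) (leb_Rd d)"
    unfolding T_def by measurable
  \<comment> \<open>A product measure is determined by its values on boxes, and the preimage of a
    box under \<open>T\<close> is a box.\<close>
  have "density (distr (leb_Rd d) (leb_Rd d) T) (\<lambda>_. ennreal (s ^ d)) = leb_Rd d"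
  proof (rule PiM_eqI)
    fix A :: "nat \<Rightarrow> real set" assume A: "\<And>i. i \<in> {..<d} \<Longrightarrow> A i \<in> sets lborel"
    define g where "g = (\<lambda>i (x::real). (1 - s) * p i + s * x)"
    have g[measurable]: "g i \<in> borel_measurable borel" for i
      unfolding g_def by measurable
    have gA: "g i -` A i \<in> sets lborel" if "i < d" for i
      using measurable_sets[OF g[of i], of "A i"] A that by simp
    have scale: "ennreal s * emeasure lborel (g i -` A i) = emeasure lborel (A i)" if "i < d" for i
    proof -
      have "lborel = density (distr lborel borel (g i)) (\<lambda>_. ennreal \<bar>s\<bar>)"
        unfolding g_def using assms by (intro lborel_real_affine) auto
      then have "emeasure lborel (A i) = emeasure (density (distr lborel borel (g i)) (\<lambda>_. ennreal \<bar>s\<bar>)) (A i)"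
        by simp
      also have "\<dots> = ennreal s * emeasure lborel (g i -` A i)"
        using assms A[of i] that by (simp add: emeasure_density_const emeasure_distr)
      finally show ?thesis by simp
    qed
    have pre: "T -` Pi\<^sub>E {..<d} A \<inter> space (leb_Rd d) = Pi\<^sub>E {..<d} (\<lambda>i. g i -` A i)"
      by (auto simp: T_def g_def space_PiM PiE_iff add.commute)
    have box: "Pi\<^sub>E {..<d} A \<in> sets (leb_Rd d)" using A by (intro sets_PiM_I_finite) auto
    have "emeasure (density (distr (leb_Rd d) (leb_Rd d) T) (\<lambda>_. ennreal (s ^ d))) (Pi\<^sub>E {..<d} A)
        = ennreal (s ^ d) * emeasure (leb_Rd d) (Pi\<^sub>E {..<d} (\<lambda>i. g i -` A i))"
      using box T by (simp add: emeasure_density_const emeasure_distr pre)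
    also have "\<dots> = (\<Prod>i<d. ennreal s) * (\<Prod>i<d. emeasure lborel (g i -` A i))"
      using gA assms by (subst emeasure_PiM) (auto simp: ennreal_power)
    also have "\<dots> = (\<Prod>i<d. emeasure lborel (A i))"
      unfolding prod.distrib[symmetric] by (intro prod.cong) (auto simp: scale)
    finally show "emeasure (density (distr (leb_Rd d) (leb_Rd d) T) (\<lambda>_. ennreal (s ^ d))) (Pi\<^sub>E {..<d} A)
        = (\<Prod>i<d. emeasure lborel (A i))" .
  qed auto
  then show ?thesis by simp
qed

lemma
  fixes d :: nat and p :: point and f :: "point \<Rightarrow> real"
  assumes "0 < s" "integrable (leb_Rd d) f"
  defines "T \<equiv> \<lambda>x. \<lambda>i\<in>{..<d}. s * x i + (1 - s) * p i"
  shows integrable_leb_Rd_homothety: "integrable (leb_Rd d) (\<lambda>x. f (T x))"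
    and integral_leb_Rd_homothety:
      "integral\<^sup>L (leb_Rd d) f = s ^ d * integral\<^sup>L (leb_Rd d) (\<lambda>x. f (T x))"
proof -
  have T: "T \<in> measurable (leb_Rd d) (leb_Rd d)"
    unfolding T_def by measurable
  have eq: "leb_Rd d = density (distr (leb_Rd d) (leb_Rd d) T) (\<lambda>_. ennreal (s ^ d))"
    unfolding T_def by (rule leb_Rd_homothety[OF assms(1)])
  have f: "f \<in> borel_measurable (leb_Rd d)" using assms by auto
  have "integrable (density (distr (leb_Rd d) (leb_Rd d) T) (\<lambda>_. ennreal (s ^ d))) f"
    using assms(2) eq by simp
  then have "integrable (distr (leb_Rd d) (leb_Rd d) T) (\<lambda>x. s ^ d * f x)"
    using f \<open>0 < s\<close> by (subst (asm) integrable_density) auto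
  then show "integrable (leb_Rd d) (\<lambda>x. f (T x))"
    using f T \<open>0 < s\<close> by (subst (asm) integrable_distr_eq) auto
  have "integral\<^sup>L (leb_Rd d) f
      = integral\<^sup>L (density (distr (leb_Rd d) (leb_Rd d) T) (\<lambda>_. ennreal (s ^ d))) f"
    using eq by simp
  also have "\<dots> = s ^ d * integral\<^sup>L (leb_Rd d) (\<lambda>x. f (T x))"
    using f T \<open>0 < s\<close> by (subst integral_density) (auto simp: integral_distr)
  finally show "integral\<^sup>L (leb_Rd d) f = s ^ d * integral\<^sup>L (leb_Rd d) (\<lambda>x. f (T x))" .
qed

section \<open>Point values of affine functions against their mean square\<close>

lemma open_simplex_finite_measure:
  assumes "open_simplex d \<tau>"
  shows "emeasure (leb_Rd d) \<tau> < \<infinity>"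
proof -
  interpret product_sigma_finite "\<lambda>_::nat. lborel :: real measure" ..
  obtain B where B: "\<And>y i. y \<in> \<tau> \<Longrightarrow> i < d \<Longrightarrow> \<bar>y i\<bar> \<le> B"
    using open_simplex_bounded[OF assms] by blast
  have "\<tau> \<subseteq> Pi\<^sub>E {..<d} (\<lambda>_. {-B..B})"
  proof
    fix y assume y: "y \<in> \<tau>"
    then have "y \<in> Rd d" using open_simplex_subset[OF assms] by auto
    then show "y \<in> Pi\<^sub>E {..<d} (\<lambda>_. {-B..B})"
      using B[OF y] by (auto simp: PiE_iff abs_le_iff) (metis minus_le_iff)
  qed
  then have "emeasure (leb_Rd d) \<tau> \<le> emeasure (leb_Rd d) (Pi\<^sub>E {..<d} (\<lambda>_. {-B..B}))"
    by (intro emeasure_mono sets_PiM_I_finite) auto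
  also have "\<dots> = (\<Prod>i<d. emeasure lborel {-B..B})"
    by (subst emeasure_PiM) auto
  also have "\<dots> < \<infinity>"
    by (simp add: emeasure_lborel_Icc_eq power_less_top_ennreal)
  finally show ?thesis .
qed

lemma open_simplex_affine_square_integrable:
  assumes "open_simplex d \<tau>"
  shows "set_integrable (leb_Rd d) \<tau> (\<lambda>x. (b + (\<Sum>i<d. a i * x i))\<^sup>2)"
proof -
  obtain B where B: "\<And>y i. y \<in> \<tau> \<Longrightarrow> i < d \<Longrightarrow> \<bar>y i\<bar> \<le> B"
    using open_simplex_bounded[OF assms] by blast
  have "norm ((b + (\<Sum>i<d. a i * x i))\<^sup>2) \<le> (\<bar>b\<bar> + (\<Sum>i<d. \<bar>a i\<bar> * B))\<^sup>2" if x: "x \<in> \<tau>" for x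
  proof -
    have "\<bar>\<Sum>i<d. a i * x i\<bar> \<le> (\<Sum>i<d. \<bar>a i\<bar> * B)"
      using B[OF x] by (intro order_trans[OF sum_abs] sum_mono) (auto simp: abs_mult mult_left_mono)
    then have "\<bar>b + (\<Sum>i<d. a i * x i)\<bar> \<le> \<bar>b\<bar> + (\<Sum>i<d. \<bar>a i\<bar> * B)" by linarith
    then have "\<bar>b + (\<Sum>i<d. a i * x i)\<bar>\<^sup>2 \<le> (\<bar>b\<bar> + (\<Sum>i<d. \<bar>a i\<bar> * B))\<^sup>2"
      by (intro power_mono) auto
    then show ?thesis by simp
  qed
  then show ?thesis
    unfolding set_integrable_def
    by (intro integrableI_bounded_set_indicator[where B = "(\<bar>b\<bar> + (\<Sum>i<d. \<bar>a i\<bar> * B))\<^sup>2"])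
       (use open_simplex_measurable[OF assms] open_simplex_finite_measure[OF assms] in auto)
qed

lemma open_simplex_affine_value_le:
  fixes d :: nat and a p :: point and b :: real
  assumes \<tau>: "open_simplex d \<tau>" and p: "p \<in> \<tau>" and d: "1 \<le> d"
  defines "f \<equiv> \<lambda>x. b + (\<Sum>i<d. a i * x i)"
  shows "(f p)\<^sup>2 * measure (leb_Rd d) \<tau> \<le> 24 * (real d)\<^sup>2 * (LINT x:\<tau>|leb_Rd d. (f x)\<^sup>2)"
proof -
  \<comment> \<open>A choice of order \<open>1/d\<close>: Bernoulli's inequality keeps
    \<open>s ^ d\<close> at least 1/2, while dividing by \<open>t^2\<close> later costs only
    \<open>4 d^2\<close>.\<close>
  define t where "t = 1 / (2 * real d)"
  define s where "s = 1 - t"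
  define T where "T = (\<lambda>x. \<lambda>i\<in>{..<d}. s * x i + (1 - s) * p i)"
  define I where "I = (LINT x:\<tau>|leb_Rd d. (f x)\<^sup>2)"
  have t: "0 < t" "t < 1" using d by (auto simp: t_def)
  then have s: "0 < s" "s < 1" by (auto simp: s_def)
  have "1 + real d * (- t) \<le> (1 + (- t)) ^ d"
    using t by (intro Bernoulli_inequality) auto
  then have sd: "1 / 2 \<le> s ^ d" using d by (simp add: s_def t_def)
  have fT: "f (T x) = s * f x + t * f p" for x
  proof -
    have "f (T x) = b + (\<Sum>i<d. a i * (s * x i + (1 - s) * p i))"
      by (simp add: f_def T_def)
    then show ?thesis
      by (simp add: f_def s_def algebra_simps sum.distrib sum_distrib_left sum_subtractf)
  qed
  have f2: "integrable (leb_Rd d) (\<lambda>x. indicator \<tau> x * (f x)\<^sup>2)"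
    using open_simplex_affine_square_integrable[OF \<tau>, of b a]
    by (simp add: f_def set_integrable_def)
  have f2T: "integrable (leb_Rd d) (\<lambda>x. indicator \<tau> (T x) * (f (T x))\<^sup>2)"
    unfolding T_def by (rule integrable_leb_Rd_homothety[OF s(1) f2])
  have I: "I = integral\<^sup>L (leb_Rd d) (\<lambda>x. indicator \<tau> x * (f x)\<^sup>2)"
    by (simp add: I_def set_lebesgue_integral_def)
  have "0 \<le> I" unfolding I by (rule integral_nonneg_AE) auto
  \<comment> \<open>The change of variables yields the integral over the preimage of \<tau> under
    \<open>T\<close>. This preimage contains \<tau>, as \<open>T\<close> maps \<tau> into itself,
    which is used in the pointwise comparison below.\<close>
  have "(1 / 2) * integral\<^sup>L (leb_Rd d) (\<lambda>x. indicator \<tau> (T x) * (f (T x))\<^sup>2)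
      \<le> s ^ d * integral\<^sup>L (leb_Rd d) (\<lambda>x. indicator \<tau> (T x) * (f (T x))\<^sup>2)"
    using sd by (intro mult_right_mono integral_nonneg_AE) auto
  also have "\<dots> = I"
    unfolding I T_def by (rule integral_leb_Rd_homothety[OF s(1) f2, symmetric])
  finally have IT: "integral\<^sup>L (leb_Rd d) (\<lambda>x. indicator \<tau> (T x) * (f (T x))\<^sup>2) \<le> 2 * I"
    by simp
  have "(t * f p)\<^sup>2 * measure (leb_Rd d) \<tau>
      = integral\<^sup>L (leb_Rd d) (\<lambda>x. (t * f p)\<^sup>2 * indicator \<tau> x)"
    using open_simplex_measurable[OF \<tau>] open_simplex_finite_measure[OF \<tau>] by simp
  also have "\<dots> \<le> integral\<^sup>L (leb_Rd d)
      (\<lambda>x. 2 * (indicator \<tau> (T x) * (f (T x))\<^sup>2) + 2 * (indicator \<tau> x * (f x)\<^sup>2))"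
  proof (rule integral_mono)
    show "integrable (leb_Rd d) (\<lambda>x. (t * f p)\<^sup>2 * indicator \<tau> x)"
      using open_simplex_measurable[OF \<tau>] open_simplex_finite_measure[OF \<tau>] by simp
    show "integrable (leb_Rd d)
        (\<lambda>x. 2 * (indicator \<tau> (T x) * (f (T x))\<^sup>2) + 2 * (indicator \<tau> x * (f x)\<^sup>2))"
      using f2 f2T by auto
    fix x
    show "(t * f p)\<^sup>2 * indicator \<tau> x
        \<le> 2 * (indicator \<tau> (T x) * (f (T x))\<^sup>2) + 2 * (indicator \<tau> x * (f x)\<^sup>2)"
    proof (cases "x \<in> \<tau>")
      case True
      have "T x \<in> \<tau>"
        unfolding T_def by (rule open_simplex_homothety[OF \<tau> True p s])
      have "(t * f p)\<^sup>2 = (f (T x) - s * f x)\<^sup>2" by (simp add: fT)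
      also have "\<dots> \<le> 2 * (f (T x))\<^sup>2 + 2 * (s * f x)\<^sup>2"
        using sum_squares_bound[of "f (T x)" "- (s * f x)"]
        by (simp add: power2_diff)
      also have "(s * f x)\<^sup>2 \<le> (f x)\<^sup>2"
        using s by (simp add: power_mult_distrib mult_left_le_one_le power_le_one)
      finally show ?thesis using True \<open>T x \<in> \<tau>\<close> by simp
    qed (simp add: indicator_def)
  qed
  also have "\<dots> = 2 * integral\<^sup>L (leb_Rd d) (\<lambda>x. indicator \<tau> (T x) * (f (T x))\<^sup>2) + 2 * I"
    using f2 f2T by (simp add: I)
  \<comment> \<open>\<open>6 = 2 * 2 + 2\<close>; division by \<open>t^2\<close> turns it into
    \<open>24 d^2\<close>.\<close>
  also have "\<dots> \<le> 6 * I" using IT by simp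
  finally show ?thesis
    using d unfolding I_def[symmetric] t_def
    by (simp add: power_mult_distrib power_divide field_simps)
qed

section \<open>Gradient, inradius and diameter\<close>

text \<open>Moving from the centre by \<open>r/2\<close> along the gradient and against it changes
  the value by plus and minus \<open>r/2\<close> times the gradient length. The two values differ by
  twice that amount, so one of them is at least that large in absolute value. Half the radius keeps
  both points in the open ball.\<close>

lemma eball_affine_value_ge:
  assumes "x \<in> Rd d" "eball d x r \<subseteq> S" "0 < r"
  obtains p where "p \<in> S" "r * L2_set a {..<d} / 2 \<le> \<bar>b + (\<Sum>i<d. a i * p i)\<bar>"
proof (cases "L2_set a {..<d} = 0")
  case True
  have "edist d x x = 0" by (simp add: edist_def L2_set_def)
  then have "x \<in> S" using assms by (auto simp: eball_def)
  with True show thesis by (intro that[of x]) auto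
next
  case False
  define A where "A = L2_set a {..<d}"
  have A: "0 < A" using False L2_set_nonneg[of a "{..<d}"] by (simp add: A_def order_less_le)
  have AA: "(\<Sum>i<d. a i * a i) = A\<^sup>2"
    by (simp add: A_def L2_set_def sum_nonneg power2_eq_square)
  define y where "y = (\<lambda>\<sigma>. \<lambda>i\<in>{..<d}. x i + \<sigma> * (r / (2 * A)) * a i)"
  have dist: "edist d x (y \<sigma>) = \<bar>\<sigma>\<bar> * r / 2" for \<sigma>
  proof -
    have "edist d x (y \<sigma>) = L2_set (\<lambda>i. \<bar>\<sigma> * (r / (2 * A))\<bar> * a i) {..<d}"
      unfolding edist_def L2_set_def y_def by (simp add: power_mult_distrib power_divide)
    also have "\<dots> = \<bar>\<sigma> * (r / (2 * A))\<bar> * A"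
      unfolding A_def by (rule L2_set_right_distrib[symmetric]) simp
    finally show ?thesis using A assms(3) by (simp add: abs_mult)
  qed
  have y: "y 1 \<in> S" "y (-1) \<in> S"
    using assms dist[of 1] dist[of "-1"] by (auto simp: eball_def y_def subset_eq)
  have val: "b + (\<Sum>i<d. a i * y \<sigma> i) = b + (\<Sum>i<d. a i * x i) + \<sigma> * (r * A / 2)" for \<sigma>
  proof -
    have "(\<Sum>i<d. a i * y \<sigma> i) = (\<Sum>i<d. a i * x i) + \<sigma> * (r / (2 * A)) * (\<Sum>i<d. a i * a i)"
      by (simp add: y_def algebra_simps sum.distrib sum_distrib_left sum_divide_distrib)
    then show ?thesis using A by (simp add: AA power2_eq_square)
  qed
  have "r * A / 2 \<le> \<bar>b + (\<Sum>i<d. a i * y 1 i)\<bar> \<or> r * A / 2 \<le> \<bar>b + (\<Sum>i<d. a i * y (-1) i)\<bar>"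
    unfolding val using mult_pos_pos[OF assms(3) A] by arith
  with y that show thesis by (auto simp: A_def)
qed

text \<open>\<open>v\<close> is affine only on \<tau>, but \<open>deriv\<close> depends only on
  values near the point, and a small ball around \<open>x\<close> lies in \<tau>.\<close>

lemma partial_deriv_affine:
  assumes \<tau>: "open_simplex d \<tau>" and v: "\<And>x. x \<in> \<tau> \<Longrightarrow> v x = b + (\<Sum>i<d. a i * x i)"
    and x: "x \<in> \<tau>" and j: "j < d"
  shows "partial_deriv j v x = a j"
proof -
  obtain r where r: "0 < r" "eball d x r \<subseteq> \<tau>"
    using open_simplex_contains_eball[OF \<tau> x] by blast
  have xR: "x \<in> Rd d" using open_simplex_subset[OF \<tau>] x by auto
  define g where "g = (\<lambda>t. b + (\<Sum>i\<in>{..<d} - {j}. a i * x i) + a j * t)"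
  have "eventually (\<lambda>t. t \<in> ball (x j) r) (nhds (x j))"
    using r by (intro eventually_nhds_in_open) auto
  then have "eventually (\<lambda>t. v (x(j := t)) = g t) (nhds (x j))"
  proof (rule eventually_mono)
    fix t assume t: "t \<in> ball (x j) r"
    have "x(j := t) \<in> eball d x r"
      using t xR j by (auto simp: eball_def edist_fun_upd dist_real_def PiE_iff extensional_def)
    then have "v (x(j := t)) = b + (\<Sum>i<d. a i * (x(j := t)) i)"
      using r v by auto
    also have "\<dots> = g t"
      using j by (subst sum.remove[of _ j]) (auto simp: g_def)
    finally show "v (x(j := t)) = g t" .
  qed
  then have "deriv (\<lambda>t. v (x(j := t))) (x j) = deriv g (x j)"
    by (intro deriv_cong_ev) auto
  also have "\<dots> = a j"
    unfolding g_def by (intro DERIV_imp_deriv) (auto intro!: derivative_eq_intros)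
  finally show ?thesis by (simp add: partial_deriv_def)
qed

text \<open>Allows the final division by the diameter, since \<open>inverse 0\<close> is 0. A ball
  inside \<tau> provides two distinct points.\<close>

lemma ediameter_open_simplex_pos:
  assumes "1 \<le> d" "open_simplex d \<tau>"
  shows "0 < ediameter d \<tau>"
proof -
  obtain x where x: "x \<in> \<tau>" using open_simplex_nonempty[OF assms(2)] by auto
  have xR: "x \<in> Rd d" using open_simplex_subset[OF assms(2)] x by auto
  obtain r where r: "0 < r" "eball d x r \<subseteq> \<tau>"
    using open_simplex_contains_eball[OF assms(2) x] by blast
  define y where "y = x(0 := x 0 + r / 2)"
  have xy: "edist d x y = r / 2"
    using assms(1) r by (simp add: y_def edist_fun_upd)
  then have "y \<in> \<tau>"
    using r xR assms(1) by (auto simp: eball_def y_def PiE_iff extensional_def subset_eq)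
  obtain B where B: "\<And>y i. y \<in> \<tau> \<Longrightarrow> i < d \<Longrightarrow> \<bar>y i\<bar> \<le> B"
    using open_simplex_bounded[OF assms(2)] by blast
  \<comment> \<open>A real \<open>SUP\<close> is known to dominate its members only if the family is
    bounded above.\<close>
  have "edist d u w \<le> (\<Sum>i<d. B + B)" if "u \<in> \<tau>" "w \<in> \<tau>" for u w
  proof -
    have "edist d u w \<le> (\<Sum>i<d. \<bar>u i - w i\<bar>)" unfolding edist_def by (rule L2_set_le_sum_abs)
    also have "\<dots> \<le> (\<Sum>i<d. B + B)"
      using that B by (intro sum_mono) (smt (verit) lessThan_iff)
    finally show ?thesis .
  qed
  then have "bdd_above ((\<lambda>(x, y). edist d x y) ` (\<tau> \<times> \<tau>))"
    by (intro bdd_aboveI[of _ "\<Sum>i<d. B + B"]) auto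
  then have "edist d x y \<le> ediameter d \<tau>"
    unfolding ediameter_def using cSUP_upper[of "(x, y)" "\<tau> \<times> \<tau>" "\<lambda>(x, y). edist d x y"] x \<open>y \<in> \<tau>\<close>
    by auto
  then show ?thesis using xy r by simp
qed

text \<open>The gradient is constant, so the seminorm is its length \<open>A\<close> times the root
  of the volume. Each ball inside \<tau> gives the bound with its radius in place of the inradius;
  the supremum over radii follows.\<close>

lemma H1_seminorm_mult_inradius_le:
  assumes d: "1 \<le> d" and \<tau>: "open_simplex d \<tau>" and v: "v \<in> P1 d \<tau>"
  shows "H1_seminorm_on d \<tau> v * inradius d \<tau> \<le> 10 * real d * L2_norm_on d \<tau> v"
proof -
  obtain a b where v: "\<And>x. x \<in> \<tau> \<Longrightarrow> v x = b + (\<Sum>i<d. a i * x i)"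
    using v by (auto simp: P1_def)
  define A where "A = L2_set a {..<d}"
  define m where "m = measure (leb_Rd d) \<tau>"
  define I where "I = (LINT x:\<tau>|leb_Rd d. (b + (\<Sum>i<d. a i * x i))\<^sup>2)"
  have \<tau>M: "\<tau> \<in> sets (leb_Rd d)" by (rule open_simplex_measurable[OF \<tau>])
  have "0 \<le> A" by (simp add: A_def)
  have "(LINT x:\<tau>|leb_Rd d. (v x)\<^sup>2) = I"
    unfolding I_def using v by (intro set_lebesgue_integral_cong[OF \<tau>M]) auto
  then have L2: "L2_norm_on d \<tau> v = sqrt I" by (simp add: L2_norm_on_def)
  have "(LINT x:\<tau>|leb_Rd d. (L2_set (\<lambda>i. partial_deriv i v x) {..<d})\<^sup>2)
      = (LINT x:\<tau>|leb_Rd d. A\<^sup>2)"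
    unfolding A_def using partial_deriv_affine[OF \<tau> v]
    by (intro set_lebesgue_integral_cong[OF \<tau>M] allI impI arg_cong[of _ _ "\<lambda>z. z\<^sup>2"] L2_set_cong) auto
  also have "\<dots> = A\<^sup>2 * m"
    using \<tau>M open_simplex_finite_measure[OF \<tau>]
    by (simp add: m_def set_lebesgue_integral_def mult.commute)
  finally have H1: "H1_seminorm_on d \<tau> v = A * sqrt m"
    using \<open>0 \<le> A\<close> by (simp add: H1_seminorm_on_def L2_norm_on_def real_sqrt_mult)
  have "0 \<le> m" by (simp add: m_def)
  have "0 \<le> I" unfolding I_def set_lebesgue_integral_def by (rule integral_nonneg_AE) auto
  have bound: "A * sqrt m * r \<le> 10 * real d * sqrt I"
    if r: "0 < r" "x \<in> Rd d" "eball d x r \<subseteq> \<tau>" for r x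
  proof -
    obtain p where p: "p \<in> \<tau>" "r * A / 2 \<le> \<bar>b + (\<Sum>i<d. a i * p i)\<bar>"
      unfolding A_def by (rule eball_affine_value_ge[OF r(2,3,1)])
    have "(r * A / 2)\<^sup>2 \<le> \<bar>b + (\<Sum>i<d. a i * p i)\<bar>\<^sup>2"
      using p r \<open>0 \<le> A\<close> by (intro power_mono) auto
    then have "(r * A / 2)\<^sup>2 * m \<le> (b + (\<Sum>i<d. a i * p i))\<^sup>2 * m"
      using \<open>0 \<le> m\<close> by (intro mult_right_mono) auto
    also have "\<dots> \<le> 24 * (real d)\<^sup>2 * I"
      unfolding m_def I_def by (rule open_simplex_affine_value_le[OF \<tau> p(1) d])
    finally have "(r * A)\<^sup>2 * m \<le> 96 * ((real d)\<^sup>2 * I)" by (simp add: power_divide)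
    \<comment> \<open>\<open>96 = 4 * 24\<close> is rounded up to a square, whence the constant
      10.\<close>
    also have "\<dots> \<le> 100 * ((real d)\<^sup>2 * I)"
      using \<open>0 \<le> I\<close> by (intro mult_right_mono) auto
    finally have "(A * sqrt m * r)\<^sup>2 \<le> (10 * real d * sqrt I)\<^sup>2"
      using \<open>0 \<le> m\<close> \<open>0 \<le> I\<close> by (simp add: power_mult_distrib mult_ac)
    then show ?thesis
      by (rule power2_le_imp_le) (use \<open>0 \<le> I\<close> in simp)
  qed
  show ?thesis
  \<comment> \<open>Passing to the supremum requires dividing by the seminorm; if it is zero, the
    left-hand side vanishes.\<close>
  proof (cases "A * sqrt m = 0")
    case True
    show ?thesis unfolding H1 L2 True using \<open>0 \<le> I\<close> by simp
  next
    case False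
    then have pos: "0 < A * sqrt m" using \<open>0 \<le> A\<close> \<open>0 \<le> m\<close> by (simp add: order_less_le)
    obtain x where x: "x \<in> \<tau>" using open_simplex_nonempty[OF \<tau>] by auto
    obtain r where "0 < r" "eball d x r \<subseteq> \<tau>"
      using open_simplex_contains_eball[OF \<tau> x] by blast
    then have "{r. 0 < r \<and> (\<exists>x \<in> Rd d. eball d x r \<subseteq> \<tau>)} \<noteq> {}"
      using x open_simplex_subset[OF \<tau>] by blast
    then have "inradius d \<tau> \<le> 10 * real d * sqrt I / (A * sqrt m)"
      unfolding inradius_def using bound pos
      by (intro cSup_least) (auto simp: pos_le_divide_eq mult.commute)
    then show ?thesis
      using pos by (simp add: H1 L2 pos_le_divide_eq mult.commute)
  qed
qed

theorem lemma4p9: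
  shows "\<exists>C::real. C > 0 \<and>
    (\<forall>(d::nat) (\<Omega>::point set) (\<T>::point set set) (\<rho>::real) (\<tau>::point set) (v::point \<Rightarrow> real).
       d \<ge> 1 \<longrightarrow> bounded_polyhedral_domain d \<Omega> \<longrightarrow> triangulation_of d \<Omega> \<T> \<longrightarrow>
       shape_regular d \<rho> \<T> \<longrightarrow> \<tau> \<in> \<T> \<longrightarrow> v \<in> P1 d \<tau> \<longrightarrow>
       H1_seminorm_on d \<tau> v
         \<le> C * \<rho> * real d powr (3/2) * inverse (ediameter d \<tau>) * L2_norm_on d \<tau> v)"
proof (intro exI[of _ 10] conjI allI impI)
  fix d \<Omega> \<T> \<rho> \<tau> v
  assume d: "1 \<le> d" and tri: "triangulation_of d \<Omega> \<T>" and reg: "shape_regular d \<rho> \<T>"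
    and "\<tau> \<in> \<T>" and v: "v \<in> P1 d \<tau>"
  have \<tau>: "open_simplex d \<tau>" using tri \<open>\<tau> \<in> \<T>\<close> by (auto simp: triangulation_of_def)
  have \<rho>: "0 < \<rho>" "ediameter d \<tau> \<le> \<rho> * inradius d \<tau>"
    using reg \<open>\<tau> \<in> \<T>\<close> by (auto simp: shape_regular_def)
  have nonneg: "0 \<le> L2_norm_on d \<sigma> w" for \<sigma> w
    unfolding L2_norm_on_def set_lebesgue_integral_def
    by (intro real_sqrt_ge_zero integral_nonneg_AE) auto
  have "H1_seminorm_on d \<tau> v * ediameter d \<tau> \<le> H1_seminorm_on d \<tau> v * (\<rho> * inradius d \<tau>)"
    using \<rho> nonneg by (intro mult_left_mono) (auto simp: H1_seminorm_on_def)
  also have "\<dots> = \<rho> * (H1_seminorm_on d \<tau> v * inradius d \<tau>)" by simp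
  also have "\<dots> \<le> \<rho> * (10 * real d * L2_norm_on d \<tau> v)"
    using \<rho> H1_seminorm_mult_inradius_le[OF d \<tau> v] by (intro mult_left_mono) auto
  \<comment> \<open>The estimate so far is linear in \<open>d\<close>, and \<open>d\<close> is at
    most \<open>d powr (3/2)\<close> because \<open>d\<close> is at least 1.\<close>
  also have "\<dots> \<le> \<rho> * (10 * real d powr (3/2) * L2_norm_on d \<tau> v)"
    using d \<rho> nonneg powr_mono[of 1 "3/2" "real d"]
    by (intro mult_left_mono mult_right_mono) auto
  finally show "H1_seminorm_on d \<tau> v
      \<le> 10 * \<rho> * real d powr (3/2) * inverse (ediameter d \<tau>) * L2_norm_on d \<tau> v"
    using ediameter_open_simplex_pos[OF d \<tau>] by (simp add: field_simps)
qed simp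

end
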